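(* Let $h:\mathbb{R}^n\to\mathbb{R}\cup\{+\infty\}$ be a convex kernel function, let $S\subseteq \operatorname{int}\operatorname{dom}(h)$ be a nonempty convex set, let $\rho>0$, and let $\varphi:\mathbb{R}^n\to\mathbb{R}\cup\{+\infty\}$. Fix any $y\in\operatorname{int}\operatorname{dom}(h)$. Then the following assertions are equivalent: (a) $\varphi$ is $\rho$-weakly convex relative to $h$ on $S$; (b) the function $x\mapsto \varphi(x)+\rho D_h(x,y)$ is convex on $S$; (c) for all $x_1,x_2\in S$ and all $\lambda\in[0,1]$, writing $x_\lambda:=\lambda x_1+(1-\lambda)x_2$, $$\varphi(x_\lambda)\le \lambda\varphi(x_1)+(1-\lambda)\varphi(x_2)+\rho\Big(\lambda D_h(x_1,x_\lambda)+(1-\lambda)D_h(x_2,x_\lambda)\Big).$$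
   Context: A kernel (distance-generating) function is a proper, lower semicontinuous, convex function $h:\mathbb{R}^n\to\mathbb{R}\cup\{+\infty\}$ with $\operatorname{int}\operatorname{dom}(h)\neq\emptyset$ that is continuously differentiable on $\operatorname{int}\operatorname{dom}(h)$. Its Bregman distance is $D_h(x,y)=h(x)-h(y)-\langle\nabla h(y),x-y\rangle$ if $y\in\operatorname{int}\operatorname{dom}(h)$, and $+\infty$ otherwise. A function $\varphi:\mathbb{R}^n\to\mathbb{R}\cup\{+\infty\}$ is $\rho$-weakly convex relative to $h$ on a nonempty convex set $S$ if $\varphi+\rho h$ is convex on $S$. Convention: $0\cdot(+\infty)=0$. *)

theory Defs
  imports "HOL-Analysis.Analysis"
begin

(* Functions into the reals extended by +infinity are rendered as ereal-valued functions that
   never take the value -infinity (avoids_minfty). The convention 0 * infinity = 0 is the one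
   built into multiplication on ereal. *)

definition avoids_minfty :: "('a \<Rightarrow> ereal) \<Rightarrow> bool" where
  "avoids_minfty f \<longleftrightarrow> (\<forall>x. f x \<noteq> -\<infinity>)"

definition eff_dom :: "('a \<Rightarrow> ereal) \<Rightarrow> 'a set" where
  "eff_dom f = {x. f x < \<infinity>}"

definition proper_fun :: "('a \<Rightarrow> ereal) \<Rightarrow> bool" where
  "proper_fun f \<longleftrightarrow> avoids_minfty f \<and> eff_dom f \<noteq> {}"

definition lsc_fun :: "('a::topological_space \<Rightarrow> ereal) \<Rightarrow> bool" where
  "lsc_fun f \<longleftrightarrow> (\<forall>x. f x \<le> Liminf (at x) f)"

(* The extended-valued counterpart of convex_on. Only meaningful for functions avoiding -infinity
   on S, since otherwise the right-hand side may be of the form infinity - infinity. *)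
definition econvex_on :: "'a::real_vector set \<Rightarrow> ('a \<Rightarrow> ereal) \<Rightarrow> bool" where
  "econvex_on S f \<longleftrightarrow> convex S \<and>
    (\<forall>x\<in>S. \<forall>y\<in>S. \<forall>u\<ge>0. \<forall>v\<ge>0. u + v = 1 \<longrightarrow>
       f (u *\<^sub>R x + v *\<^sub>R y) \<le> ereal u * f x + ereal v * f y)"

(* The gradient of the real-valued function that f induces where it is finite; it is only used at
   interior points of eff_dom f, around which f and its real part agree. *)
definition egradient :: "('a::real_inner \<Rightarrow> ereal) \<Rightarrow> 'a \<Rightarrow> 'a" where
  "egradient f x = (THE D. GDERIV (\<lambda>z. real_of_ereal (f z)) x :> D)"

definition kernel_fun :: "('a::euclidean_space \<Rightarrow> ereal) \<Rightarrow> bool" where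
  "kernel_fun h \<longleftrightarrow>
     proper_fun h \<and> lsc_fun h \<and> econvex_on UNIV h \<and>
     interior (eff_dom h) \<noteq> {} \<and>
     (\<forall>x\<in>interior (eff_dom h). \<exists>D. GDERIV (\<lambda>z. real_of_ereal (h z)) x :> D) \<and>
     continuous_on (interior (eff_dom h)) (egradient h)"

definition bregman :: "('a::euclidean_space \<Rightarrow> ereal) \<Rightarrow> 'a \<Rightarrow> 'a \<Rightarrow> ereal" where
  "bregman h x y =
     (if y \<in> interior (eff_dom h)
      then h x - h y - ereal (egradient h y \<bullet> (x - y))
      else \<infinity>)"

definition weakly_convex_rel ::
    "real \<Rightarrow> ('a::real_vector \<Rightarrow> ereal) \<Rightarrow> 'a set \<Rightarrow> ('a \<Rightarrow> ereal) \<Rightarrow> bool" where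
  "weakly_convex_rel \<rho> h S \<phi> \<longleftrightarrow> econvex_on S (\<lambda>x. \<phi> x + ereal \<rho> * h x)"

end

theory Submission
  imports Defs
begin

text \<open>
  Since \<open>h\<close> is finite on \<open>S\<close>, all three assertions bound the convexity defect of \<open>\<phi>\<close> by a
  real number, namely \<open>\<rho>\<close> times the Jensen gap of a finite function. The three gaps agree:
  \<open>h\<close> and \<open>D_h(-, y)\<close> differ by an affine function, which has zero gap, and the averaged
  gradient term in \<open>D_h(x\<^sub>i, x\<^sub>\<lambda>)\<close> vanishes because \<open>x\<^sub>\<lambda>\<close> is the barycentre.
\<close>

text \<open>The shifts \<open>p\<close>, \<open>q\<close>, \<open>s\<close> are real, so they cross
  the inequality even where \<open>a\<close>, \<open>b\<close> or \<open>c\<close> is infinite. An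
  infinite \<open>a\<close> or \<open>b\<close> disappears exactly when its weight is zero, whence
  the case splits on \<open>u = 0\<close> and \<open>v = 0\<close>.\<close>

lemma ereal_jensen_shift:
  fixes a b c :: ereal and u v p q s :: real
  assumes "a \<noteq> -\<infinity>" "b \<noteq> -\<infinity>" "c \<noteq> -\<infinity>" "u \<ge> 0" "v \<ge> 0"
  shows "c + ereal s \<le> ereal u * (a + ereal p) + ereal v * (b + ereal q) \<longleftrightarrow>
         c \<le> ereal u * a + ereal v * b + ereal (u * p + v * q - s)"
  using assms
  by (cases a; cases b; cases c; cases "u = 0"; cases "v = 0")
     (simp_all add: distrib_left, linarith+)

text \<open>Isolates the finite summand: it enters the convexity condition only through its Jensen
  gap, so summands with equal gaps give the same condition. The single weight \<open>l\<close>
  matches the form of assertion (c).\<close>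

lemma econvex_on_add_finite_iff:
  fixes f g :: "'a::real_vector \<Rightarrow> ereal" and k :: "'a \<Rightarrow> real"
  assumes "convex S" "avoids_minfty f" and g: "\<forall>x\<in>S. g x = ereal (k x)"
  shows "econvex_on S (\<lambda>x. f x + g x) \<longleftrightarrow>
    (\<forall>x1\<in>S. \<forall>x2\<in>S. \<forall>l\<in>{0..1}.
       f (l *\<^sub>R x1 + (1 - l) *\<^sub>R x2) \<le> ereal l * f x1 + ereal (1 - l) * f x2
         + ereal (l * k x1 + (1 - l) * k x2 - k (l *\<^sub>R x1 + (1 - l) *\<^sub>R x2)))"
proof -
  \<comment> \<open>Convexity of \<open>S\<close> makes \<open>g\<close> finite at the combination
    as well, so all three shifts are values of \<open>k\<close>.\<close>
  have step: "f (u *\<^sub>R x1 + v *\<^sub>R x2) + g (u *\<^sub>R x1 + v *\<^sub>R x2)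
          \<le> ereal u * (f x1 + g x1) + ereal v * (f x2 + g x2) \<longleftrightarrow>
        f (u *\<^sub>R x1 + v *\<^sub>R x2) \<le> ereal u * f x1 + ereal v * f x2
          + ereal (u * k x1 + v * k x2 - k (u *\<^sub>R x1 + v *\<^sub>R x2))"
    if "x1 \<in> S" "x2 \<in> S" "u \<ge> 0" "v \<ge> 0" "u + v = 1" for x1 x2 u v
    using assms(2) unfolding bspec[OF g that(1)] bspec[OF g that(2)]
      bspec[OF g convexD[OF assms(1) that]]
    by (intro ereal_jensen_shift) (use that in \<open>auto simp: avoids_minfty_def\<close>)
  have weights: "(\<forall>u\<ge>0. \<forall>v\<ge>0. u + v = 1 \<longrightarrow> P u v) \<longleftrightarrow> (\<forall>l\<in>{0..1}. P l (1 - l))"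
    for P :: "real \<Rightarrow> real \<Rightarrow> bool"
  proof safe
    fix u v :: real
    assume "\<forall>l\<in>{0..1}. P l (1 - l)" "u \<ge> 0" "v \<ge> 0" "u + v = 1"
    moreover from this have "v = 1 - u" "u \<in> {0..1}"
      by auto
    ultimately show "P u v"
      by blast
  qed auto
  show ?thesis
    unfolding econvex_on_def weights using assms(1) by (simp add: step)
qed

lemma bregman_eq_ereal:
  assumes "avoids_minfty h" "x \<in> eff_dom h" "y \<in> interior (eff_dom h)"
  shows "bregman h x y =
    ereal (real_of_ereal (h x) - real_of_ereal (h y) - egradient h y \<bullet> (x - y))"
proof -
  have "h z = ereal (real_of_ereal (h z))" if "z \<in> eff_dom h" for z
    using that assms(1) by (auto simp: eff_dom_def avoids_minfty_def ereal_real)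
  moreover have "y \<in> eff_dom h"
    using assms(3) interior_subset by blast
  ultimately show ?thesis
    using assms by (metis bregman_def ereal_minus(1))
qed

theorem proposition3p4:
  fixes h \<phi> :: "real ^ 'n \<Rightarrow> ereal"
    and S :: "(real ^ 'n) set"
    and \<rho> :: real
    and y :: "real ^ 'n"
  assumes "kernel_fun h"
    and "S \<subseteq> interior (eff_dom h)"
    and "S \<noteq> {}"
    and "convex S"
    and "\<rho> > 0"
    and "avoids_minfty \<phi>"
    and "y \<in> interior (eff_dom h)"
  shows "(weakly_convex_rel \<rho> h S \<phi> \<longleftrightarrow>
            econvex_on S (\<lambda>x. \<phi> x + ereal \<rho> * bregman h x y)) \<and>
         (econvex_on S (\<lambda>x. \<phi> x + ereal \<rho> * bregman h x y) \<longleftrightarrow>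
            (\<forall>x1\<in>S. \<forall>x2\<in>S. \<forall>l\<in>{0..1::real}.
               let xl = l *\<^sub>R x1 + (1 - l) *\<^sub>R x2 in
               \<phi> xl \<le> ereal l * \<phi> x1 + ereal (1 - l) * \<phi> x2
                 + ereal \<rho> * (ereal l * bregman h x1 xl + ereal (1 - l) * bregman h x2 xl)))"
proof -
  define r where "r x = real_of_ereal (h x)" for x
  \<comment> \<open>The base point comes first, so that \<open>d z\<close> is the real form of the
    Bregman distance to \<open>z\<close> as a function of \<open>x\<close>.\<close>
  define d where "d z x = r x - r z - egradient h z \<bullet> (x - z)" for z x
  have minf: "avoids_minfty h"
    using assms(1) by (simp add: kernel_fun_def proper_fun_def)
  have dom: "x \<in> eff_dom h" if "x \<in> S" for x
    using that assms(2) interior_subset by blast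
  have D: "bregman h x z = ereal (d z x)" if "x \<in> S" "z \<in> interior (eff_dom h)" for x z
    using bregman_eq_ereal[OF minf dom] that by (simp add: d_def r_def)
  \<comment> \<open>The base point \<open>z\<close> stays free: (b) uses \<open>z = y\<close>, while
    (c) uses the moving point \<open>z = xl\<close>.\<close>
  have affine: "l * d z x1 + (1 - l) * d z x2 - d z (l *\<^sub>R x1 + (1 - l) *\<^sub>R x2)
      = l * r x1 + (1 - l) * r x2 - r (l *\<^sub>R x1 + (1 - l) *\<^sub>R x2)" for l z x1 x2
    by (simp add: d_def inner_diff_right inner_add_right algebra_simps)
  have gap_y: "l * (\<rho> * d y x1) + (1 - l) * (\<rho> * d y x2) - \<rho> * d y (l *\<^sub>R x1 + (1 - l) *\<^sub>R x2)
      = l * (\<rho> * r x1) + (1 - l) * (\<rho> * r x2) - \<rho> * r (l *\<^sub>R x1 + (1 - l) *\<^sub>R x2)" for l x1 x2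
    using arg_cong[OF affine[of l y x1 x2], of "(*) \<rho>"] by (simp add: algebra_simps)
  have gap_xl: "ereal \<rho> * (ereal l * bregman h x1 xl + ereal (1 - l) * bregman h x2 xl)
      = ereal (l * (\<rho> * r x1) + (1 - l) * (\<rho> * r x2) - \<rho> * r xl)"
    if "x1 \<in> S" "x2 \<in> S" "l \<in> {0..1}" "xl = l *\<^sub>R x1 + (1 - l) *\<^sub>R x2" for l x1 x2 xl
  proof -
    \<comment> \<open>Convexity keeps \<open>xl\<close> in the interior of the domain, so
      \<open>bregman\<close> does not take its default value \<infinity> there.\<close>
    have "xl \<in> S"
      using that convexD[OF assms(4), of x1 x2 l "1 - l"] by simp
    then have "xl \<in> interior (eff_dom h)"
      using assms(2) by blast
    \<comment> \<open>With base point \<open>xl\<close> the subtracted term of the gap vanishes,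
      leaving just the average that appears in (c).\<close>
    moreover have "d xl xl = 0"
      by (simp add: d_def)
    then have "l * d xl x1 + (1 - l) * d xl x2 = l * r x1 + (1 - l) * r x2 - r xl"
      using affine[of l xl x1 x2] that(4) by simp
    then have "\<rho> * (l * d xl x1 + (1 - l) * d xl x2)
        = l * (\<rho> * r x1) + (1 - l) * (\<rho> * r x2) - \<rho> * r xl"
      by (simp only:) (simp add: algebra_simps)
    ultimately show ?thesis
      using that(1,2) by (simp add: D)
  qed
  have "ereal \<rho> * h x = ereal (\<rho> * r x)" if "x \<in> S" for x
    using dom[OF that] minf
    by (cases "h x") (auto simp: r_def eff_dom_def avoids_minfty_def)
  then have "\<forall>x\<in>S. ereal \<rho> * h x = ereal (\<rho> * r x)"
    by blast
  note a = econvex_on_add_finite_iff[OF assms(4,6) this]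
  have "\<forall>x\<in>S. ereal \<rho> * bregman h x y = ereal (\<rho> * d y x)"
    using D assms(7) by simp
  note b = econvex_on_add_finite_iff[OF assms(4,6) this, unfolded gap_y]
  \<comment> \<open>By \<open>a\<close> and \<open>b\<close> the first two assertions become
    literally the same inequality. \<open>ball_cong\<close> supplies the memberships under which
    \<open>gap_xl\<close> rewrites (c) into it.\<close>
  show ?thesis
    unfolding weakly_convex_rel_def a b Let_def
    by (simp only: gap_xl[OF _ _ _ refl] cong: ball_cong)
qed

end
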